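(* Let $G$ be a finite simple graph that is $(P_3\cup P_2,\text{ kite})$-free, i.e. $G$ has no induced subgraph isomorphic to $P_3\cup P_2$ and no induced subgraph isomorphic to the kite. Then $\chi(G)\le 2\omega(G)$.
   Context: All graphs are finite and simple. $\chi(G)$ is the chromatic number of $G$ and $\omega(G)$ is the clique number (maximum size of a clique). $P_k$ denotes the path on $k$ vertices. For vertex-disjoint graphs $A,B$, the union $A\cup B$ is their disjoint union (vertex set $V(A)\cup V(B)$, edge set $E(A)\cup E(B)$); thus $P_3\cup P_2$ has 5 vertices $a,b,c,d,e$ and exactly the edges $ab,bc,de$. The kite is the graph on 5 vertices $a,b,c,d,e$ with exactly the edges $ab,ac,bc,bd,cd,ae$; that is, $K_4$ minus an edge (a diamond, in which $a,d$ are the two nonadjacent degree-2 vertices) together with a pendant vertex $e$ attached to the degree-2 vertex $a$ of the diamond. *)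

theory Defs
  imports "Graph_Theory.Digraph_Isomorphism"
begin

text \<open>
  A finite simple graph is a member of the locale \<^locale>\<open>graph\<close>: finite, no loops, no parallel
  arcs, each edge represented by its two opposite arcs.
\<close>

subsection \<open>Forbidden induced subgraphs\<close>

definition free_of :: "('c, 'd) pre_digraph \<Rightarrow> ('a, 'b) pre_digraph \<Rightarrow> bool" where
  "free_of F G \<longleftrightarrow> \<not> (\<exists>H. induced_subgraph H G \<and> digraph_iso F H)"

definition path_graph :: "nat \<Rightarrow> nat pair_pre_digraph" where
  "path_graph k =
     \<lparr> pverts = {..<k}, parcs = {(i, j). i < k \<and> j < k \<and> (j = Suc i \<or> i = Suc j)} \<rparr>"

definition disjoint_union ::
    "'a pair_pre_digraph \<Rightarrow> 'b pair_pre_digraph \<Rightarrow> ('a + 'b) pair_pre_digraph" where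
  "disjoint_union A B =
     \<lparr> pverts = pverts A <+> pverts B,
       parcs = map_prod Inl Inl ` parcs A \<union> map_prod Inr Inr ` parcs B \<rparr>"

abbreviation P3_union_P2 :: "(nat + nat) pair_pre_digraph" where
  "P3_union_P2 \<equiv> disjoint_union (path_graph 3) (path_graph 2)"

text \<open>
  The vertices \<open>0, 1, 2, 3\<close> carry the diamond, with \<open>0\<close> and \<open>3\<close> nonadjacent; \<open>4\<close> is the pendant
  vertex attached to \<open>0\<close>.
\<close>
definition kite :: "nat pair_pre_digraph" where
  "kite = (let E = {(0, 1), (0, 2), (1, 2), (1, 3), (2, 3), (0, 4)}
           in \<lparr> pverts = {..<5}, parcs = E \<union> E\<inverse> \<rparr>)"

subsection \<open>Cliques and colourings\<close>

definition clique :: "('a, 'b) pre_digraph \<Rightarrow> 'a set \<Rightarrow> bool" where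
  "clique G K \<longleftrightarrow> K \<subseteq> verts G \<and> (\<forall>u\<in>K. \<forall>v\<in>K. u \<noteq> v \<longrightarrow> u \<rightarrow>\<^bsub>G\<^esub> v)"

definition clique_number :: "('a, 'b) pre_digraph \<Rightarrow> nat" where
  "clique_number G = Max {card K | K. clique G K}"

definition proper_colouring :: "('a, 'b) pre_digraph \<Rightarrow> nat \<Rightarrow> ('a \<Rightarrow> nat) \<Rightarrow> bool" where
  "proper_colouring G k c \<longleftrightarrow>
     c ` verts G \<subseteq> {..<k} \<and> (\<forall>u v. u \<rightarrow>\<^bsub>G\<^esub> v \<longrightarrow> c u \<noteq> c v)"

definition chromatic_number :: "('a, 'b) pre_digraph \<Rightarrow> nat" where
  "chromatic_number G = (LEAST k. \<exists>c. proper_colouring G k c)"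

subsection \<open>Well-definedness\<close>

text \<open>For a finite simple graph the maximum and the minimum above are attained.\<close>

lemma (in graph) finite_clique_sizes: "finite {card K | K. clique G K}"
proof -
  have "{card K | K. clique G K} \<subseteq> card ` Pow (verts G)"
    by (auto simp: clique_def)
  then show ?thesis
    by (rule finite_subset) simp
qed

lemma (in graph) clique_number_attained: "\<exists>K. clique G K \<and> card K = clique_number G"
proof -
  have "clique G {}"
    by (simp add: clique_def)
  then have "clique_number G \<in> {card K | K. clique G K}"
    unfolding clique_number_def using finite_clique_sizes Max_in by blast
  then show ?thesis by auto
qed

lemma (in graph) chromatic_number_attained: "\<exists>c. proper_colouring G (chromatic_number G) c"
proof -
  obtain c where c: "bij_betw c (verts G) {0..<card (verts G)}"
    using ex_bij_betw_finite_nat finite_verts by blast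
  have "c u \<noteq> c v" if "u \<rightarrow>\<^bsub>G\<^esub> v" for u v
  proof -
    have "u \<in> verts G" "v \<in> verts G" "u \<noteq> v"
      using that adj_in_verts adj_not_same by auto
    then show ?thesis using c by (auto simp: bij_betw_def inj_on_def)
  qed
  then have "proper_colouring G (card (verts G)) c"
    using c by (auto simp: proper_colouring_def bij_betw_def)
  then have "\<exists>c. proper_colouring G (card (verts G)) c"
    by (rule exI[where x = c])
  then show ?thesis
    unfolding chromatic_number_def by (rule LeastI)
qed

lemma pair_graph_path_graph: "pair_graph (path_graph k)"
proof
  have "parcs (path_graph k) \<subseteq> {..<k} \<times> {..<k}"
    by (auto simp: path_graph_def)
  then show "finite (parcs (path_graph k))"
    by (rule finite_subset) simp
qed (auto simp: path_graph_def symmetric_def arcs_ends_def arc_to_ends_def sym_def)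

lemma pair_graph_disjoint_union:
  assumes "pair_graph A" "pair_graph B"
  shows "pair_graph (disjoint_union A B)"
proof -
  interpret A: pair_graph A by fact
  interpret B: pair_graph B by fact
  have "sym (parcs A)" "sym (parcs B)"
    using A.sym_arcs B.sym_arcs
    by (auto simp: symmetric_def arcs_ends_def arc_to_ends_def)
  then show ?thesis
    by unfold_locales
      (auto simp: disjoint_union_def symmetric_def arcs_ends_def arc_to_ends_def sym_def
        dest: A.in_arcsD1 A.in_arcsD2 B.in_arcsD1 B.in_arcsD2 A.no_loops B.no_loops)
qed

lemma pair_graph_kite: "pair_graph kite"
  by unfold_locales
    (auto simp: kite_def Let_def symmetric_def arcs_ends_def arc_to_ends_def sym_def)

lemma parcs_P3_union_P2:
  "parcs P3_union_P2 =
     (let E = {(Inl 0, Inl 1), (Inl 1, Inl 2), (Inr 0, Inr 1)} in E \<union> E\<inverse>)"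
proof -
  have "parcs (path_graph 3) = {(0, 1), (1, 0), (1, 2), (2, 1)}"
       "parcs (path_graph 2) = {(0, 1), (1, 0)}"
    by (auto simp: path_graph_def)
  then show ?thesis by (auto simp: disjoint_union_def Let_def)
qed

text \<open>
  For simple graphs, an induced subgraph isomorphic to \<open>F\<close> is an injection of the vertices that
  preserves and reflects adjacency.
\<close>
lemma free_of_iff:
  assumes "pair_graph F" "graph G"
  shows "free_of (with_proj F) G \<longleftrightarrow>
    \<not> (\<exists>f. inj_on f (pverts F) \<and> f ` pverts F \<subseteq> verts G \<and>
         (\<forall>u\<in>pverts F. \<forall>v\<in>pverts F. (u, v) \<in> parcs F \<longleftrightarrow> f u \<rightarrow>\<^bsub>G\<^esub> f v))"
    (is "_ \<longleftrightarrow> \<not> (\<exists>f. ?emb f)")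
proof -
  interpret F: pair_graph F by fact
  interpret G: graph G by fact
  have *: "\<exists>f. ?emb f" if H: "induced_subgraph H G" and iso: "digraph_iso (with_proj F) H" for H
  proof -
    from iso obtain h where h: "pre_digraph.digraph_isomorphism (with_proj F) h"
      and H_eq: "H = app_iso h (with_proj F)"
      by (auto simp: digraph_iso_def)
    define f where "f = iso_verts h"
    have inj: "inj_on f (pverts F)"
      using h by (simp add: pre_digraph.digraph_isomorphism_def f_def)
    have ends: "f (fst a) = tail H (iso_arcs h a)" "f (snd a) = head H (iso_arcs h a)"
      if "a \<in> parcs F" for a
      using h that by (auto simp: pre_digraph.digraph_isomorphism_def f_def H_eq)
    have vH: "verts H = f ` pverts F" and aH: "arcs H = iso_arcs h ` parcs F"
      by (simp_all add: H_eq f_def)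
    have sub: "verts H \<subseteq> verts G" "tail H = tail G" "head H = head G"
      and arcs: "arcs H = {e \<in> arcs G. tail G e \<in> verts H \<and> head G e \<in> verts H}"
      using H by (auto simp: induced_subgraph_def subgraph_def compatible_def)
    have "(u, v) \<in> parcs F \<longleftrightarrow> f u \<rightarrow>\<^bsub>G\<^esub> f v" if uv: "u \<in> pverts F" "v \<in> pverts F" for u v
    proof
      assume a: "(u, v) \<in> parcs F"
      then have "iso_arcs h (u, v) \<in> arcs G" using aH arcs by blast
      then show "f u \<rightarrow>\<^bsub>G\<^esub> f v"
        using ends[OF a] sub by (auto simp: arcs_ends_conv intro!: image_eqI)
    next
      assume "f u \<rightarrow>\<^bsub>G\<^esub> f v"
      then obtain e where e: "e \<in> arcs G" "tail G e = f u" "head G e = f v"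
        by (rule reachableE)
      then have "e \<in> arcs H" using arcs vH uv by auto
      then obtain a where a: "a \<in> parcs F" "e = iso_arcs h a" using aH by auto
      then have "f (fst a) = f u" "f (snd a) = f v" using ends[OF a(1)] e sub by auto
      moreover have "fst a \<in> pverts F" "snd a \<in> pverts F"
        using a(1) F.arc_fst_in_verts F.arc_snd_in_verts by auto
      ultimately have "fst a = u" "snd a = v" using inj uv by (auto dest: inj_onD)
      then show "(u, v) \<in> parcs F" using a by (cases a) auto
    qed
    then show ?thesis using inj vH sub(1) by blast
  qed
  have **: "\<exists>H. induced_subgraph H G \<and> digraph_iso (with_proj F) H" if "?emb f" for f
  proof -
    have inj: "inj_on f (pverts F)" and f_in: "f ` pverts F \<subseteq> verts G"
      and adj: "\<And>u v. u \<in> pverts F \<Longrightarrow> v \<in> pverts F \<Longrightarrow> (u, v) \<in> parcs F \<longleftrightarrow> f u \<rightarrow>\<^bsub>G\<^esub> f v"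
      using that by auto
    define g where "g a = (SOME e. e \<in> arcs G \<and> tail G e = f (fst a) \<and> head G e = f (snd a))" for a
    have g: "g a \<in> arcs G \<and> tail G (g a) = f (fst a) \<and> head G (g a) = f (snd a)"
      if "a \<in> parcs F" for a
    proof -
      have "f (fst a) \<rightarrow>\<^bsub>G\<^esub> f (snd a)"
        using adj[of "fst a" "snd a"] that F.arc_fst_in_verts F.arc_snd_in_verts by auto
      then have "\<exists>e. e \<in> arcs G \<and> tail G e = f (fst a) \<and> head G e = f (snd a)"
        by (auto simp: arcs_ends_conv)
      then show ?thesis unfolding g_def by (rule someI_ex)
    qed
    define h where "h = \<lparr>iso_verts = f, iso_arcs = g, iso_head = head G, iso_tail = tail G\<rparr>"
    have "inj_on g (parcs F)"
    proof (rule inj_onI)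
      fix a b assume ab: "a \<in> parcs F" "b \<in> parcs F" "g a = g b"
      then have "f (fst a) = f (fst b)" "f (snd a) = f (snd b)"
        using g[OF ab(1)] g[OF ab(2)] by auto
      then show "a = b"
        using inj ab F.arc_fst_in_verts F.arc_snd_in_verts by (auto intro!: prod_eqI dest: inj_onD)
    qed
    then have "pre_digraph.digraph_isomorphism (with_proj F) h"
      using inj g F.wf_digraph by (simp add: pre_digraph.digraph_isomorphism_def h_def)
    moreover have "app_iso h (with_proj F) = G \<restriction> (f ` pverts F)"
    proof -
      have "g ` parcs F = {e \<in> arcs G. tail G e \<in> f ` pverts F \<and> head G e \<in> f ` pverts F}"
      proof (intro set_eqI iffI)
        fix e assume "e \<in> g ` parcs F"
        then obtain a where a: "a \<in> parcs F" "e = g a" by auto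
        then have "fst a \<in> pverts F" "snd a \<in> pverts F"
          using F.arc_fst_in_verts[OF a(1)] F.arc_snd_in_verts[OF a(1)] by auto
        then show "e \<in> {e \<in> arcs G. tail G e \<in> f ` pverts F \<and> head G e \<in> f ` pverts F}"
          using g[OF a(1)] a(2) by simp
      next
        fix e assume "e \<in> {e \<in> arcs G. tail G e \<in> f ` pverts F \<and> head G e \<in> f ` pverts F}"
        then obtain u v where e: "e \<in> arcs G" "u \<in> pverts F" "v \<in> pverts F"
          "tail G e = f u" "head G e = f v" by auto
        then have "f u \<rightarrow>\<^bsub>G\<^esub> f v" by (auto simp: arcs_ends_conv intro!: image_eqI)
        then have uv: "(u, v) \<in> parcs F" using adj e by blast
        then have "g (u, v) = e"
          using g[OF uv] e G.no_multi_arcs by (auto simp: arc_to_ends_def)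
        then show "e \<in> g ` parcs F" using uv by blast
      qed
      then show ?thesis by (simp add: app_iso_def h_def induce_subgraph_def)
    qed
    ultimately have "digraph_iso (with_proj F) (G \<restriction> (f ` pverts F))"
      unfolding digraph_iso_def by metis
    then show ?thesis using G.induced_induce[OF f_in] by blast
  qed
  have "(\<exists>H. induced_subgraph H G \<and> digraph_iso (with_proj F) H) \<longleftrightarrow> (\<exists>f. ?emb f)"
  proof
    assume "\<exists>H. induced_subgraph H G \<and> digraph_iso (with_proj F) H"
    then obtain H where "induced_subgraph H G" "digraph_iso (with_proj F) H" by (elim exE conjE)
    then show "\<exists>f. ?emb f" by (rule *)
  next
    assume "\<exists>f. ?emb f"
    then obtain f where "?emb f" by (rule exE)
    then show "\<exists>H. induced_subgraph H G \<and> digraph_iso (with_proj F) H" by (rule **)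
  qed
  then show ?thesis by (simp only: free_of_def)
qed

end

theory Submission
  imports Defs
begin

text \<open>
  Take a counterexample with as few vertices as possible and a maximum clique \<open>K\<close>, and classify
  every vertex \<open>x\<close> by the set \<open>M x\<close> of vertices of \<open>K\<close> that it misses. By minimality the common
  neighbourhood of a clique \<open>C\<close> can be coloured with two colours less per vertex of \<open>C\<close>, so for
  nonempty \<open>C \<subseteq> K\<close> the vertices that miss something in \<open>C\<close> can never be coloured with \<open>2|C|\<close>
  colours. Kite-freeness makes the sets \<open>M x\<close> almost laminar: two of them that intersect are nested
  or differ by exchanging one element. This excludes \<open>|M x| \<ge> 3\<close>. What remains is a graph \<open>N\<close> on
  \<open>K\<close> whose edges are the two-element sets \<open>M x\<close>. At a vertex \<open>i\<close> of degree at least 3, all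
  vertices missing \<open>i\<close> induce a bipartite graph, which is impossible; so \<open>N\<close> consists of paths and
  cycles, and walking along one of them yields a forbidden colouring, because the vertices with
  \<open>M x = {i}\<close> and those with \<open>M x = {i, j}\<close> together need only two colours as soon as \<open>i\<close> has a
  neighbour other than \<open>j\<close>.
\<close>

section \<open>Colourings of vertex sets under an adjacency relation\<close>

text \<open>Working with a bare relation lets the induction pass to subsets of the vertices without
  forming subgraphs.\<close>

locale simple_adjacency =
  fixes adj :: "'a \<Rightarrow> 'a \<Rightarrow> bool" (infix "\<sim>" 50)
  assumes adj_sym: "u \<sim> v \<Longrightarrow> v \<sim> u"
    and adj_irrefl: "\<not> u \<sim> u"
begin

lemma adj_commute: "u \<sim> v \<longleftrightarrow> v \<sim> u"
  using adj_sym by blast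

definition complete :: "'a set \<Rightarrow> bool" where
  "complete L \<longleftrightarrow> (\<forall>u\<in>L. \<forall>v\<in>L. u \<noteq> v \<longrightarrow> u \<sim> v)"

definition colourable :: "nat \<Rightarrow> 'a set \<Rightarrow> bool" where
  "colourable k A \<longleftrightarrow>
     (\<exists>c :: 'a \<Rightarrow> nat. c ` A \<subseteq> {..<k} \<and> (\<forall>u\<in>A. \<forall>v\<in>A. u \<sim> v \<longrightarrow> c u \<noteq> c v))"

lemma colourable_mono:
  assumes "colourable l B" "A \<subseteq> B" "l \<le> k"
  shows "colourable k A"
proof -
  obtain c :: "'a \<Rightarrow> nat" where c: "c ` B \<subseteq> {..<l}" "\<forall>u\<in>B. \<forall>v\<in>B. u \<sim> v \<longrightarrow> c u \<noteq> c v"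
    using assms(1) unfolding colourable_def by blast
  have "c ` A \<subseteq> {..<k}" using c(1) assms(2,3) by fastforce
  moreover have "\<forall>u\<in>A. \<forall>v\<in>A. u \<sim> v \<longrightarrow> c u \<noteq> c v" using c(2) assms(2) by blast
  ultimately show ?thesis unfolding colourable_def by blast
qed

lemma colourable_Un:
  assumes "colourable k A" "colourable l B"
  shows "colourable (k + l) (A \<union> B)"
proof -
  obtain c :: "'a \<Rightarrow> nat" where c: "c ` A \<subseteq> {..<k}" "\<forall>u\<in>A. \<forall>v\<in>A. u \<sim> v \<longrightarrow> c u \<noteq> c v"
    using assms(1) unfolding colourable_def by blast
  obtain d :: "'a \<Rightarrow> nat" where d: "d ` B \<subseteq> {..<l}" "\<forall>u\<in>B. \<forall>v\<in>B. u \<sim> v \<longrightarrow> d u \<noteq> d v"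
    using assms(2) unfolding colourable_def by blast
  define h where "h x = (if x \<in> A then c x else k + d x)" for x
  have "h ` (A \<union> B) \<subseteq> {..<k + l}"
    using c(1) d(1) by (fastforce simp: h_def)
  moreover have "h u \<noteq> h v" if uv: "u \<in> A \<union> B" "v \<in> A \<union> B" "u \<sim> v" for u v
  proof -
    have "c x < k" if "x \<in> A" for x using c(1) that by auto
    then have "c x \<noteq> k + y" if "x \<in> A" for x y using that by fastforce
    then show ?thesis using uv c(2) d(2) unfolding h_def
      by (metis Un_iff add_left_cancel)
  qed
  ultimately show ?thesis unfolding colourable_def by blast
qed

lemma colourable_independent:
  assumes "\<And>u v. u \<in> A \<Longrightarrow> v \<in> A \<Longrightarrow> \<not> u \<sim> v"
  shows "colourable 1 A"
  unfolding colourable_def by (rule exI[of _ "\<lambda>_. 0"]) (use assms in auto)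

lemma colourable_bipartite:
  fixes P :: "'a \<Rightarrow> bool"
  assumes "\<And>u v. u \<in> A \<Longrightarrow> v \<in> A \<Longrightarrow> u \<sim> v \<Longrightarrow> P u \<noteq> P v"
  shows "colourable 2 A"
  unfolding colourable_def by (rule exI[of _ "\<lambda>x. if P x then 1 else 0"]) (use assms in auto)

lemma colourable_UN:
  assumes "finite I" "\<And>i. i \<in> I \<Longrightarrow> colourable k (A i)"
  shows "colourable (k * card I) (\<Union>i\<in>I. A i)"
  using assms
proof (induction I rule: finite_induct)
  case empty
  show ?case by (simp add: colourable_def)
next
  case (insert i I)
  then have "colourable (k + k * card I) (A i \<union> (\<Union>i\<in>I. A i))"
    by (intro colourable_Un) auto
  then show ?case using insert.hyps by simp
qed

text \<open>The neighbours of \<open>x\<close> in \<open>A\<close> use fewer than \<open>k\<close>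
  colours, so one colour is left for \<open>x\<close>.\<close>

lemma colourable_insert:
  assumes "colourable k A" "finite A" "card {y \<in> A. x \<sim> y} < k"
  shows "colourable k (insert x A)"
proof -
  obtain c :: "'a \<Rightarrow> nat" where c: "c ` A \<subseteq> {..<k}" "\<forall>u\<in>A. \<forall>v\<in>A. u \<sim> v \<longrightarrow> c u \<noteq> c v"
    using assms(1) unfolding colourable_def by blast
  have "card (c ` {y \<in> A. x \<sim> y}) < card {..<k}"
    using assms(2,3) card_image_le[of "{y \<in> A. x \<sim> y}" c] by simp
  moreover have "finite (c ` {y \<in> A. x \<sim> y})" using assms(2) by simp
  ultimately have "\<not> {..<k} \<subseteq> c ` {y \<in> A. x \<sim> y}"
    using card_mono leD by blast
  then obtain p where p: "p < k" "p \<notin> c ` {y \<in> A. x \<sim> y}" by blast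
  have "(c(x := p)) ` insert x A \<subseteq> {..<k}" using c(1) p(1) by auto
  moreover have "(c(x := p)) u \<noteq> (c(x := p)) v"
    if uv: "u \<in> insert x A" "v \<in> insert x A" "u \<sim> v" for u v
  proof -
    have "c y \<noteq> p" if "y \<in> A" "x \<sim> y" for y using p(2) that by blast
    moreover have "u \<noteq> v" "v \<sim> u" using uv(3) adj_irrefl adj_sym by blast+
    ultimately show ?thesis using uv c(2) by (cases "u = x"; cases "v = x") auto
  qed
  ultimately show ?thesis unfolding colourable_def by blast
qed

lemma colourable_greedy:
  assumes "finite A" "\<And>x. x \<in> A \<Longrightarrow> card {y \<in> A. x \<sim> y} \<le> d"
  shows "colourable (Suc d) A"
proof -
  have "colourable (Suc d) B" if "finite B" "B \<subseteq> A" for B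
    using that
  proof (induction B rule: finite_induct)
    case empty
    show ?case by (simp add: colourable_def)
  next
    case (insert x B)
    have "card {y \<in> B. x \<sim> y} \<le> card {y \<in> A. x \<sim> y}"
      using insert.prems assms(1) by (intro card_mono) auto
    also have "\<dots> \<le> d" using insert.prems assms(2) by auto
    finally show ?case using insert by (intro colourable_insert) auto
  qed
  then show ?thesis using assms(1) by blast
qed

end

section \<open>Forbidden configurations and a minimal counterexample\<close>

text \<open>The listed adjacencies and nonadjacencies already force the five vertices apart, except
  for the two ends of the path, whence \<open>a \<noteq> c\<close>.\<close>

locale kite_P3P2_free = simple_adjacency +
  assumes kite_free: "\<lbrakk>a \<sim> b; a \<sim> c; b \<sim> c; b \<sim> d; c \<sim> d; a \<sim> e;
      \<not> a \<sim> d; \<not> e \<sim> b; \<not> e \<sim> c; \<not> e \<sim> d\<rbrakk> \<Longrightarrow> False"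
    and P3_P2_free: "\<lbrakk>a \<sim> b; b \<sim> c; a \<noteq> c; \<not> a \<sim> c; d \<sim> e;
      \<not> a \<sim> d; \<not> a \<sim> e; \<not> b \<sim> d; \<not> b \<sim> e; \<not> c \<sim> d; \<not> c \<sim> e\<rbrakk> \<Longrightarrow> False"

text \<open>A proper subset is measured against its own clique bound \<open>m\<close>, which may be
  smaller than \<open>card K\<close>; this is where colours are saved.\<close>

locale minimal_counterexample = kite_P3P2_free +
  fixes V K :: "'a set"
  assumes finite_V: "finite V"
    and K_subset: "K \<subseteq> V"
    and K_complete: "complete K"
    and K_maximum: "L \<subseteq> V \<Longrightarrow> complete L \<Longrightarrow> card L \<le> card K"
    and smaller_colourable:
      "W \<subset> V \<Longrightarrow> (\<And>L. L \<subseteq> W \<Longrightarrow> complete L \<Longrightarrow> card L \<le> m) \<Longrightarrow> colourable (2 * m) W"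
    and not_colourable: "\<not> colourable (2 * card K) V"
begin

text \<open>By irreflexivity a vertex of \<open>K\<close> misses exactly itself, so the vertices of
  \<open>K\<close> are classified together with all others.\<close>

definition M :: "'a \<Rightarrow> 'a set" where
  "M x = {v \<in> K. \<not> x \<sim> v}"

lemma finite_K: "finite K"
  using K_subset finite_V by (rule finite_subset)

lemma M_subset: "M x \<subseteq> K"
  by (auto simp: M_def)

lemma finite_M: "finite (M x)"
  using M_subset finite_K by (rule finite_subset)

lemma in_M: "v \<in> M x \<Longrightarrow> v \<in> K \<and> \<not> x \<sim> v \<and> \<not> v \<sim> x"
  by (auto simp: M_def dest: adj_sym)

lemma notin_M: "v \<in> K \<Longrightarrow> v \<notin> M x \<Longrightarrow> x \<sim> v \<and> v \<sim> x"
  by (auto simp: M_def dest: adj_sym)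

lemma self_in_M: "v \<in> K \<Longrightarrow> v \<in> M v"
  by (auto simp: M_def adj_irrefl)

lemma K_adj: "u \<in> K \<Longrightarrow> v \<in> K \<Longrightarrow> u \<noteq> v \<Longrightarrow> u \<sim> v"
  using K_complete by (auto simp: complete_def)

text \<open>Every vertex of \<open>L\<close> sees all of \<open>K - e\<close>, so
  \<open>L \<union> (K - e)\<close> is a clique, and it is no larger than \<open>K\<close>.\<close>

lemma clique_card_le:
  assumes "L \<subseteq> V" "complete L" "e \<subseteq> K" "\<And>x. x \<in> L \<Longrightarrow> M x \<subseteq> e"
  shows "card L \<le> card e"
proof -
  have disj: "L \<inter> (K - e) = {}" using self_in_M assms(4) by blast
  have fin: "finite L" "finite e" using assms finite_V finite_K finite_subset by blast+
  have "u \<sim> v \<and> v \<sim> u" if "u \<in> L" "v \<in> K - e" for u v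
    using that assms(4)[of u] notin_M[of v u] by blast
  then have "complete (L \<union> (K - e))"
    using assms(2) K_adj by (auto simp: complete_def)
  then have "card (L \<union> (K - e)) \<le> card K"
    using assms(1) K_subset by (intro K_maximum) auto
  moreover have "card (L \<union> (K - e)) = card L + (card K - card e)"
    using disj fin finite_K assms(3) by (simp add: card_Un_disjoint card_Diff_subset)
  moreover have "card e \<le> card K" using assms(3) finite_K by (rule card_mono[rotated])
  ultimately show ?thesis by simp
qed

lemma M_nonempty: "x \<in> V \<Longrightarrow> M x \<noteq> {}"
  using clique_card_le[of "{x}" "{}"] by (auto simp: complete_def)

lemma singleton_class_independent:
  assumes "x \<in> V" "y \<in> V" "M x = {i}" "M y = {i}"
  shows "\<not> x \<sim> y"
proof
  assume "x \<sim> y"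
  then have "x \<noteq> y" "complete {x, y}"
    using adj_irrefl adj_sym by (auto simp: complete_def)
  then show False
    using clique_card_le[of "{x, y}" "{i}"] assms M_subset[of x] by auto
qed

lemma colourable_class_1: "colourable 1 {x \<in> V. M x = {i}}"
  by (rule colourable_independent) (use singleton_class_independent in auto)

text \<open>Otherwise \<open>x\<close>, \<open>y\<close>, \<open>z\<close> form an induced path with
  no edge to the edge \<open>i\<close>, \<open>j\<close> of \<open>K\<close>.\<close>

lemma no_P3_missing_two:
  assumes "x \<sim> y" "y \<sim> z" "x \<noteq> z" "i \<noteq> j" "{i, j} \<subseteq> M x \<inter> M y \<inter> M z"
  shows "x \<sim> z"
proof (rule ccontr)
  assume "\<not> x \<sim> z"
  then show False
    using assms P3_P2_free[of x y z i j] K_adj[of i j] by (auto dest: in_M)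
qed

text \<open>The class has no induced path on three vertices, and its cliques have at most two
  vertices by \<open>clique_card_le\<close>; so its edges form a matching.\<close>

lemma colourable_class_2:
  assumes "card e = 2"
  shows "colourable 2 {x \<in> V. M x = e}"
proof -
  obtain i j where e: "e = {i, j}" "i \<noteq> j" using assms by (auto simp: card_2_iff)
  let ?D = "{x \<in> V. M x = e}"
  have "card {y \<in> ?D. x \<sim> y} \<le> 1" if x: "x \<in> ?D" for x
  proof -
    have "y = z" if yz: "y \<in> ?D" "z \<in> ?D" "x \<sim> y" "x \<sim> z" for y z
    proof (rule ccontr)
      assume "y \<noteq> z"
      then have "y \<sim> z"
        using no_P3_missing_two[of y x z i j] x yz e adj_sym by auto
      then have "complete {x, y, z}"
        using yz adj_sym by (auto simp: complete_def)
      moreover have "e \<subseteq> K" using x M_subset by auto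
      ultimately have "card {x, y, z} \<le> 2"
        using clique_card_le[of "{x, y, z}" e] x yz assms by auto
      moreover have "x \<noteq> y" "x \<noteq> z" using yz adj_irrefl by auto
      ultimately show False using \<open>y \<noteq> z\<close> by simp
    qed
    then show ?thesis
      using finite_V card_le_Suc0_iff_eq[of "{y \<in> ?D. x \<sim> y}"] by auto
  qed
  then have "colourable (Suc 1) ?D"
    using finite_V by (intro colourable_greedy) auto
  then show ?thesis by (simp add: numeral_2_eq_2)
qed

text \<open>Cliques in this set have at most \<open>card (K - C)\<close> vertices by
  \<open>clique_card_le\<close>, and the set is a proper part of \<open>V\<close> because it avoids
  \<open>C\<close>.\<close>

lemma colourable_disjoint:
  assumes "C \<subseteq> K" "C \<noteq> {}"
  shows "colourable (2 * (card K - card C)) {x \<in> V. M x \<inter> C = {}}"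
proof (rule smaller_colourable)
  obtain v where "v \<in> C" using assms by blast
  then show "{x \<in> V. M x \<inter> C = {}} \<subset> V"
    using assms K_subset self_in_M[of v] by blast
  fix L assume L: "L \<subseteq> {x \<in> V. M x \<inter> C = {}}" "complete L"
  have "card L \<le> card (K - C)"
    using L M_subset by (intro clique_card_le) auto
  then show "card L \<le> card K - card C"
    using assms(1) finite_K by (simp add: card_Diff_subset finite_subset)
qed

lemma not_colourable_meeting:
  assumes "C \<subseteq> K" "C \<noteq> {}"
  shows "\<not> colourable (2 * card C) {x \<in> V. M x \<inter> C \<noteq> {}}"
proof
  assume *: "colourable (2 * card C) {x \<in> V. M x \<inter> C \<noteq> {}}"
  have "card C \<le> card K" using assms finite_K by (simp add: card_mono)
  moreover have "V \<subseteq> {x \<in> V. M x \<inter> C = {}} \<union> {x \<in> V. M x \<inter> C \<noteq> {}}" by blast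
  ultimately show False
    using colourable_mono[OF colourable_Un[OF colourable_disjoint[OF assms] *]] not_colourable
    by (simp add: algebra_simps)
qed

section \<open>Near-laminarity of the sets \<open>M x\<close>\<close>

text \<open>Adjacency of \<open>x\<close> and \<open>y\<close> decides the case. If they are
  adjacent, a commonly missed \<open>i\<close> gives the diamond \<open>x\<close>, \<open>j\<close>,
  \<open>k\<close>, \<open>i\<close> with pendant \<open>y\<close> at \<open>x\<close>. If not, an
  \<open>i\<close> missed by \<open>x\<close> only gives the diamond \<open>i\<close>,
  \<open>j\<close>, \<open>k\<close>, \<open>x\<close> with pendant \<open>y\<close> at
  \<open>i\<close>.\<close>

lemma two_missing:
  assumes "x \<in> V" "y \<in> V" "j \<in> M y - M x" "k \<in> M y - M x" "j \<noteq> k"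
  shows "M x \<subseteq> M y \<and> \<not> x \<sim> y \<or> M x \<inter> M y = {} \<and> x \<sim> y"
proof -
  have jk: "x \<sim> j" "x \<sim> k" "j \<sim> x" "k \<sim> x" "\<not> y \<sim> j" "\<not> y \<sim> k" "j \<sim> k" "j \<in> K" "k \<in> K"
    using assms K_adj in_M notin_M by auto
  have A: "\<not> x \<sim> y" if "i \<in> M x" "i \<in> M y" for i
  proof
    assume "x \<sim> y"
    moreover have "j \<sim> i" "k \<sim> i" using K_adj in_M[OF that(1)] jk assms(3,4) that by auto
    ultimately show False
      using kite_free[of x j k i y] jk in_M[OF that(1)] in_M[OF that(2)] by auto
  qed
  have D: "x \<sim> y" if "i \<in> M x" "i \<notin> M y" for i
  proof (rule ccontr)
    assume "\<not> x \<sim> y"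
    moreover have "i \<sim> j" "i \<sim> k" using K_adj in_M[OF that(1)] jk assms(3,4) that by auto
    ultimately show False
      using kite_free[of i j k x y] jk in_M[OF that(1)] notin_M[of i y] that adj_commute by auto
  qed
  show ?thesis using A D M_nonempty[OF assms(1)] by blast
qed

text \<open>If \<open>x\<close> sees both ends, \<open>t\<close>, \<open>b\<close>,
  \<open>b'\<close>, \<open>x\<close> is a diamond with pendant \<open>i\<close> at
  \<open>t\<close>. If it sees neither, the path \<open>x\<close>, \<open>j\<close>,
  \<open>i\<close> and the edge \<open>b\<close>, \<open>b'\<close> form the other forbidden
  graph.\<close>

lemma edge_split:
  assumes "b \<sim> b'" "M b = M b'" "i \<in> M b \<inter> M x" "j \<in> M b - M x" "t \<in> M x - M b"
  shows "(x \<sim> b) \<noteq> (x \<sim> b')"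
proof -
  have *: "x \<sim> j" "j \<sim> i" "t \<sim> i" "t \<sim> b" "t \<sim> b'" "\<not> x \<sim> i" "\<not> i \<sim> x" "\<not> t \<sim> x" 
    "\<not> i \<sim> b" "\<not> i \<sim> b'" "\<not> j \<sim> b" "\<not> j \<sim> b'" "x \<noteq> i"
    using assms in_M notin_M K_adj[of j i] K_adj[of t i] self_in_M by auto
  have "\<not> (x \<sim> b \<and> x \<sim> b')"
    using kite_free[of t b b' x i] * assms(1) adj_commute by auto
  moreover have "x \<sim> b \<or> x \<sim> b'"
    using P3_P2_free[of x j i b b'] * assms(1) adj_commute by auto
  ultimately show ?thesis by blast
qed

lemma smaller_M_subset:
  assumes "x \<in> V" "y \<in> V" "M x \<inter> M y \<noteq> {}" "card (M x) < card (M y)"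
  shows "M x \<subseteq> M y"
proof (rule ccontr)
  assume not_sub: "\<not> M x \<subseteq> M y"
  then have "j = k" if "j \<in> M y - M x" "k \<in> M y - M x" for j k
    using two_missing[OF assms(1,2) that] assms(3) by blast
  then have "card (M y - M x) \<le> 1"
    using finite_M card_le_Suc0_iff_eq[of "M y - M x"] by auto
  moreover have "card (M x - M y) \<ge> 1"
    using not_sub finite_M by (simp add: Suc_le_eq card_gt_0_iff)
  moreover have "card (M x) = card (M x - M y) + card (M x \<inter> M y)"
    "card (M y) = card (M y - M x) + card (M x \<inter> M y)"
    using finite_M card_Int_Diff by (metis Int_commute add.commute)+
  ultimately show False using assms(4) by simp
qed

text \<open>By \<open>two_missing\<close>, \<open>M y - M x\<close> has at most one element;
  comparing sizes makes both differences singletons.\<close>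

lemma exchange:
  assumes "x \<in> V" "y \<in> V" "M x \<inter> M y \<noteq> {}" "\<not> M x \<subseteq> M y" "card (M x) \<le> card (M y)"
  shows "card (M x) = card (M y)" "\<exists>i. M x - M y = {i}" "\<exists>i. M y - M x = {i}"
proof -
  show eq: "card (M x) = card (M y)"
    using smaller_M_subset assms by fastforce
  have "j = k" if "j \<in> M y - M x" "k \<in> M y - M x" for j k
    using two_missing[OF assms(1,2) that] assms(3,4) by blast
  then have "card (M y - M x) \<le> 1"
    using finite_M card_le_Suc0_iff_eq[of "M y - M x"] by auto
  moreover have "card (M x - M y) \<ge> 1"
    using assms(4) finite_M by (simp add: Suc_le_eq card_gt_0_iff)
  moreover have "card (M x) = card (M x - M y) + card (M x \<inter> M y)"
    "card (M y) = card (M y - M x) + card (M x \<inter> M y)"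
    using finite_M card_Int_Diff by (metis Int_commute add.commute)+
  ultimately have "card (M x - M y) = 1" "card (M y - M x) = 1"
    using eq by auto
  then show "\<exists>i. M x - M y = {i}" "\<exists>i. M y - M x = {i}"
    by (simp_all add: card_1_singleton_iff)
qed

section \<open>No vertex misses three vertices of \<open>K\<close>\<close>

text \<open>Such an \<open>x\<close> would have fewer than \<open>2 * card K\<close> neighbours, so
  a colouring of \<open>V - {x}\<close> would extend to \<open>x\<close>.\<close>

lemma M_not_K:
  assumes "x \<in> V" "card K \<ge> 3"
  shows "M x \<noteq> K"
proof
  assume MxK: "M x = K"
  define Q where "Q = {y \<in> V. x \<sim> y \<and> M y = K}"
  define D where "D i = {y \<in> V. x \<sim> y \<and> M y = K - {i}}" for i
  have fin: "finite Q" "finite (D i)" for i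
    using finite_V by (auto simp: Q_def D_def)
  have nbrs: "{y \<in> V. x \<sim> y} \<subseteq> Q \<union> (\<Union>i\<in>K. D i)"
  proof
    fix y assume y: "y \<in> {y \<in> V. x \<sim> y}"
    \<comment> \<open>If \<open>y\<close> saw two vertices of \<open>K\<close>, then by
      \<open>two_missing\<close> it would be nonadjacent to \<open>x\<close> or miss nothing in
      \<open>K\<close>.\<close>
    have "j = k" if "j \<in> K - M y" "k \<in> K - M y" for j k
      using two_missing[of y x j k] that y assms(1) MxK M_nonempty[of y] M_subset[of y] adj_sym
      by auto
    then have "K - M y = {} \<or> (\<exists>i\<in>K. K - M y = {i})" by blast
    then have "M y = K \<or> (\<exists>i\<in>K. M y = K - {i})" using M_subset[of y] by blast
    then show "y \<in> Q \<union> (\<Union>i\<in>K. D i)"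
      using y by (auto simp: Q_def D_def)
  qed
  have two: "\<exists>i j. i \<noteq> j \<and> {i, j} \<subseteq> K - {p}" for p
  proof -
    have "2 \<le> card (K - {p})"
      using assms(2) finite_K card_Diff_singleton_if[of K p] by (auto split: if_splits)
    then obtain S where "S \<subseteq> K - {p}" "card S = 2"
      by (meson obtain_subset_with_card_n)
    then show ?thesis by (auto simp: card_2_iff)
  qed
  \<comment> \<open>Hence \<open>Q\<close> together with \<open>x\<close> is a clique, which bounds
    \<open>Q\<close> by \<open>card K - 1\<close>.\<close>
  have "y \<sim> z" if yz: "y \<in> Q" "z \<in> Q" "y \<noteq> z" for y z
  proof -
    obtain i j where "i \<noteq> j" "{i, j} \<subseteq> K - {x}" using two by blast
    then show ?thesis
      using no_P3_missing_two[of y x z i j] yz MxK adj_sym by (auto simp: Q_def)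
  qed
  moreover have "x \<sim> y \<and> y \<sim> x" if "y \<in> Q" for y
    using that adj_sym[of x y] by (simp add: Q_def)
  ultimately have "complete (insert x Q)"
    by (simp add: complete_def)
  then have "card (insert x Q) \<le> card K"
    using assms(1) by (intro K_maximum) (auto simp: Q_def)
  moreover have "x \<notin> Q" using adj_irrefl by (simp add: Q_def)
  ultimately have cQ: "card Q < card K" using fin by simp
  \<comment> \<open>Two vertices of \<open>D p\<close> would be adjacent by
    \<open>no_P3_missing_two\<close>, and \<open>p\<close>, \<open>y\<close>, \<open>z\<close>,
    \<open>x\<close> would be a diamond with pendant \<open>i\<close> at \<open>p\<close>.\<close>
  have "card (D p) \<le> 1" if p: "p \<in> K" for p
  proof -
    obtain i j where ij: "i \<noteq> j" "{i, j} \<subseteq> K - {p}" using two by blast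
    have "y = z" if yz: "y \<in> D p" "z \<in> D p" for y z
    proof (rule ccontr)
      assume "y \<noteq> z"
      then have "y \<sim> z"
        using no_P3_missing_two[of y x z i j] yz MxK adj_sym ij by (auto simp: D_def)
      moreover have "p \<sim> y" "p \<sim> z" "p \<sim> i" "\<not> p \<sim> x" "\<not> i \<sim> y" "\<not> i \<sim> z" "\<not> i \<sim> x"
        using yz ij p MxK notin_M[of p y] notin_M[of p z] in_M K_adj[of p i]
        by (auto simp: D_def)
      ultimately show False
        using kite_free[of p y z x i] yz adj_sym by (auto simp: D_def)
    qed
    then show ?thesis using fin card_le_Suc0_iff_eq[of "D p"] by auto
  qed
  then have "(\<Sum>i\<in>K. card (D i)) \<le> card K"
    using sum_bounded_above[of K "\<lambda>i. card (D i)" 1] by simp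
  then have "card (\<Union>i\<in>K. D i) \<le> card K"
    using card_UN_le[OF finite_K, of D] by linarith
  then have "card (Q \<union> (\<Union>i\<in>K. D i)) < 2 * card K"
    using cQ card_Un_le[of Q "\<Union>i\<in>K. D i"] by linarith
  then have "card {y \<in> V. x \<sim> y} < 2 * card K"
    using nbrs fin finite_K by (meson card_mono finite_UN finite_UnI le_less_trans)
  moreover have "{y \<in> V - {x}. x \<sim> y} = {y \<in> V. x \<sim> y}" using adj_irrefl by auto
  moreover have "colourable (2 * card K) (V - {x})"
    using assms(1) K_maximum by (intro smaller_colourable) auto
  ultimately have "colourable (2 * card K) (insert x (V - {x}))"
    using finite_V by (intro colourable_insert) auto
  then show False
    using not_colourable assms(1) by (simp add: insert_absorb)
qed

text \<open>On an edge \<open>b\<close>, \<open>b'\<close>, \<open>edge_split\<close> makes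
  \<open>x\<close> see exactly one end, whereas \<open>no_P3_missing_two\<close> makes it see both
  or neither.\<close>

lemma exchange_class_independent:
  assumes "x \<in> V" "i \<noteq> j" "{i, j} \<subseteq> M b \<inter> M x" "\<not> M b \<subseteq> M x" "\<not> M x \<subseteq> M b" "M b = M b'"
  shows "\<not> b \<sim> b'"
proof
  assume bb': "b \<sim> b'"
  obtain p t where "p \<in> M b - M x" "t \<in> M x - M b" using assms by blast
  then have split: "(x \<sim> b) \<noteq> (x \<sim> b')"
    using edge_split[OF bb'] assms by blast
  have "x \<noteq> b" "x \<noteq> b'" using assms by auto
  then have "x \<sim> b \<longleftrightarrow> x \<sim> b'"
    using no_P3_missing_two[of x b b' i j] no_P3_missing_two[of x b' b i j]
      assms(2,3,6) bb' adj_sym[OF bb'] by blast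
  then show False using split by blast
qed

text \<open>A largest \<open>M x0\<close> with at least three elements is crossed by another set.
  The sets around their union \<open>U\<close> then have such a rigid form that the vertices meeting
  a suitable \<open>P \<subseteq> K\<close> need only \<open>2 * card P\<close> colours.\<close>

lemma card_M_le_2:
  assumes "x \<in> V"
  shows "card (M x) \<le> 2"
proof (rule ccontr)
  assume "\<not> card (M x) \<le> 2"
  moreover obtain x0 where x0: "x0 \<in> V" and max: "\<And>y. y \<in> V \<Longrightarrow> card (M y) \<le> card (M x0)"
  proof -
    let ?S = "(\<lambda>x. card (M x)) ` V"
    have "Max ?S \<in> ?S" using assms finite_V by (intro Max_in) auto
    then obtain x0 where "x0 \<in> V" "card (M x0) = Max ?S" by auto
    then show thesis using that finite_V by simp
  qed
  ultimately have m3: "card (M x0) \<ge> 3" using max[OF assms] by simp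
  then have "M x0 \<noteq> K"
    using M_not_K[OF x0] card_mono[OF finite_K M_subset[of x0]] by linarith
  then have C: "K - M x0 \<subseteq> K" "K - M x0 \<noteq> {}" using M_subset[of x0] by auto
  \<comment> \<open>Without a crossing set, every vertex missing something outside
    \<open>M x0\<close> sees all of \<open>M x0\<close>, and \<open>colourable_disjoint\<close>
    colours these vertices too cheaply.\<close>
  have "\<exists>x1\<in>V. M x1 \<inter> M x0 \<noteq> {} \<and> \<not> M x1 \<subseteq> M x0"
  proof (rule ccontr)
    assume "\<not> (\<exists>x1\<in>V. M x1 \<inter> M x0 \<noteq> {} \<and> \<not> M x1 \<subseteq> M x0)"
    then have "{x \<in> V. M x \<inter> (K - M x0) \<noteq> {}} \<subseteq> {x \<in> V. M x \<inter> M x0 = {}}" by blast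
    moreover have "card (K - M x0) = card K - card (M x0)"
      using finite_M M_subset by (simp add: card_Diff_subset)
    ultimately have "colourable (2 * card (K - M x0)) {x \<in> V. M x \<inter> (K - M x0) \<noteq> {}}"
      using colourable_mono[OF colourable_disjoint[of "M x0"]] M_subset[of x0]
        M_nonempty[OF x0] by auto
    then show False using not_colourable_meeting[OF C] by blast
  qed
  then obtain x1 where x1: "x1 \<in> V" "M x1 \<inter> M x0 \<noteq> {}" "\<not> M x1 \<subseteq> M x0" by blast
  obtain i j where ij: "M x1 - M x0 = {i}" "M x0 - M x1 = {j}"
    using exchange[OF x1(1) x0 x1(2,3) max[OF x1(1)]] by blast
  define U where "U = M x0 \<union> M x1"
  have U: "M x0 = U - {i}" "M x1 = U - {j}" "i \<in> U" "j \<in> U" "i \<noteq> j" "U \<subseteq> K"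
    using ij M_subset unfolding U_def by blast+
  have finU: "finite U" using U(6) finite_K by (rule finite_subset)
  have cardU: "card U = Suc (card (M x0))"
    using card_Suc_Diff1[OF finU U(3)] U(1) by simp
  \<comment> \<open>\<open>P\<close> collects the points whose complement in \<open>U\<close> occurs
    as a set \<open>M x\<close>; it contains both exchanged elements \<open>i\<close> and
    \<open>j\<close>.\<close>
  define P where "P = {p \<in> U. \<exists>x\<in>V. M x = U - {p}}"
  have "i \<in> P" "j \<in> P" using U x0 x1 by (auto simp: P_def)
  have P: "P \<subseteq> K" "P \<noteq> {}" using U(6) \<open>i \<in> P\<close> by (auto simp: P_def)
  have other: "\<exists>q\<in>P. q \<noteq> p" for p
    using \<open>i \<in> P\<close> \<open>j \<in> P\<close> U(5) by (cases "p = i") auto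
  have card_P: "card (U - {p}) = card (M x0)" if "p \<in> P" for p
    using that cardU by (simp add: P_def)
  have classify: "M y = {p} \<or> (\<exists>q\<in>P. M y = U - {q})" if y: "y \<in> V" and p: "p \<in> P" "p \<in> M y" for y p
  proof -
    obtain z where z: "z \<in> V" "M z = U - {p}" using p by (auto simp: P_def)
    have le: "card (M y) \<le> card (M z)" using max[OF y] card_P[OF p(1)] z by simp
    have "\<not> M y \<subseteq> M z" using p z by auto
    show ?thesis
    proof (cases "M y \<inter> M z = {}")
      case False
      then obtain s where s: "M y - M z = {s}" and "card (M y) = card (M z)"
        using exchange[OF y z(1) _ \<open>\<not> M y \<subseteq> M z\<close> le] by blast
      have "p \<in> M y - M z" using p z by simp
      then have "M y - M z = {p}" unfolding s by simp
      then have "M y \<subseteq> insert p (M z)" using Diff_subset_conv[of "M y" "M z" "{p}"] by simp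
      then have sub: "M y \<subseteq> U" using z p by (auto simp: P_def)
      have "card (U - M y) = 1"
        using sub finite_M \<open>card (M y) = card (M z)\<close> cardU card_P[OF p(1)] z
        by (simp add: card_Diff_subset)
      then obtain q where q: "U - M y = {q}" by (auto simp: card_1_singleton_iff)
      then have "M y = U - {q}" using double_diff[OF sub order_refl] by simp
      moreover have "q \<in> U" using q by blast
      ultimately show ?thesis using y by (auto simp: P_def)
    next
      case True
      have "M y = {p}"
      proof (rule ccontr)
        assume "M y \<noteq> {p}"
        \<comment> \<open>This \<open>r\<close> lies outside \<open>U\<close>. Comparing with
          \<open>U - {q}\<close>, which contains \<open>p\<close>, \<open>exchange\<close> would
          leave a one-element difference, but \<open>U\<close> without \<open>p\<close> and
          \<open>q\<close> has at least two elements.\<close>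
        then obtain r where r: "r \<in> M y" "r \<noteq> p" using p by blast
        then have "r \<notin> U" using True z by auto
        obtain q where q: "q \<in> P" "q \<noteq> p" using other by blast
        then obtain w where w: "w \<in> V" "M w = U - {q}" by (auto simp: P_def)
        have "p \<in> M w" using p q w by (auto simp: P_def)
        moreover have "\<not> M y \<subseteq> M w" using r \<open>r \<notin> U\<close> w by auto
        moreover have "card (M y) \<le> card (M w)" using max[OF y] card_P[OF q(1)] w by simp
        ultimately obtain s where "M w - M y = {s}"
          using exchange[OF y w(1)] p by blast
        moreover have "M w - M y = (U - {q}) - {p}" using True p unfolding z w by blast
        moreover have "card ((U - {q}) - {p}) = card (M x0) - 1"
          using card_P[OF q(1)] \<open>p \<in> M w\<close> w(2) by simp
        ultimately show False using m3 by simp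
      qed
      then show ?thesis by blast
    qed
  qed
  have indep: "\<not> b \<sim> b'" if p: "p \<in> P" and b: "M b = U - {p}" "M b' = U - {p}" for p b b'
  proof -
    obtain q where q: "q \<in> P" "q \<noteq> p" using other by blast
    then obtain w where w: "w \<in> V" "M w = U - {q}" by (auto simp: P_def)
    have "2 \<le> card (U - {p} - {q})"
      using card_P[OF p] q m3 by (simp add: card_Diff_singleton_if P_def)
    then obtain S where S: "S \<subseteq> U - {p} - {q}" "card S = 2"
      by (meson obtain_subset_with_card_n)
    then obtain s t where "S = {s, t}" "s \<noteq> t" by (auto simp: card_2_iff)
    then show ?thesis
      using exchange_class_independent[of w s t b b'] w b S p q by (auto simp: P_def)
  qed
  \<comment> \<open>Both classes are independent, so each \<open>p\<close> is charged one colour for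
    each of them.\<close>
  have "colourable 2 ({x \<in> V. M x = {p}} \<union> {x \<in> V. M x = U - {p}})" if "p \<in> P" for p
  proof -
    have "colourable 1 {x \<in> V. M x = U - {p}}"
      using indep[OF that] by (intro colourable_independent) auto
    from colourable_Un[OF colourable_class_1 this] show ?thesis
      by (simp only: one_add_one)
  qed
  then have "colourable (2 * card P) (\<Union>p\<in>P. {x \<in> V. M x = {p}} \<union> {x \<in> V. M x = U - {p}})"
    using P(1) finite_K by (intro colourable_UN) (auto intro: finite_subset)
  moreover have "{x \<in> V. M x \<inter> P \<noteq> {}} \<subseteq> (\<Union>p\<in>P. {x \<in> V. M x = {p}} \<union> {x \<in> V. M x = U - {p}})"
    using classify by fast
  ultimately show False
    using not_colourable_meeting[OF P] colourable_mono by blast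
qed

section \<open>Parity of adjacency among vertices missing a common vertex\<close>

text \<open>If \<open>b\<close> sees both \<open>n\<close> and \<open>x\<close>, the diamond
  \<open>j\<close>, \<open>x\<close>, \<open>n\<close>, \<open>b\<close> has pendant
  \<open>i\<close> at \<open>j\<close>. If it sees neither, the diamond \<open>k\<close>,
  \<open>n\<close>, \<open>j\<close>, \<open>x\<close> has pendant \<open>b\<close> at
  \<open>k\<close>.\<close>

lemma triangle_parity:
  assumes "x \<in> V" "b \<in> V" "n \<in> V" "M n = {i}" "M b = {i, j}" "M x = {i, k}"
    and "i \<noteq> j" "i \<noteq> k" "j \<noteq> k" "n \<sim> x"
  shows "(b \<sim> n) \<noteq> (b \<sim> x)"
proof -
  have K: "i \<in> K" "j \<in> K" "k \<in> K" using M_subset[of b] M_subset[of x] assms by auto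
  have a: "i \<sim> j" "j \<sim> k" "k \<sim> j" "j \<sim> n" "n \<sim> j" "k \<sim> n" "j \<sim> x" "x \<sim> j" "k \<sim> b"
    "\<not> i \<sim> n" "\<not> i \<sim> x" "\<not> i \<sim> b" "\<not> j \<sim> b" "\<not> b \<sim> j" "\<not> k \<sim> x"
    using K assms notin_M[of j n] notin_M[of k n] notin_M[of j x] notin_M[of k b]
      in_M[of i n] in_M[of i x] in_M[of i b] in_M[of j b] in_M[of k x] K_adj by auto
  have "\<not> (b \<sim> n \<and> b \<sim> x)"
    using kite_free[of j x n b i] a assms(10) adj_sym by blast
  moreover have "b \<sim> n \<or> b \<sim> x"
    using kite_free[of k n j x b] a assms(10) by blast
  ultimately show ?thesis by blast
qed

text \<open>In other words, the three vertices span zero or two edges. An edge \<open>x\<close>,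
  \<open>y\<close> whose ends are both seen, or both missed, by \<open>t\<close> yields a kite: the
  diamond \<open>j\<close>, \<open>x\<close>, \<open>t\<close>, \<open>y\<close> with pendant
  \<open>i\<close>, or \<open>j\<close>, \<open>x\<close>, \<open>l\<close>, \<open>y\<close> with
  pendant \<open>t\<close>, each attached at \<open>j\<close>.\<close>

lemma triple_parity:
  assumes "x \<in> V" "y \<in> V" "t \<in> V" "M y = {i, j}" "M x = {i, k}" "M t = {i, l}"
    and "i \<notin> {j, k, l}" "j \<noteq> k" "k \<noteq> l" "j \<noteq> l"
  shows "(y \<sim> t) \<longleftrightarrow> (y \<sim> x) \<noteq> (x \<sim> t)"
proof -
  have one: False
    if V: "x \<in> V" "y \<in> V" "t \<in> V" and M: "M y = {i, j}" "M x = {i, k}" "M t = {i, l}"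
      and ne: "i \<notin> {j, k, l}" "j \<noteq> k" "k \<noteq> l" "j \<noteq> l"
      and e: "x \<sim> y" "(t \<sim> x) = (t \<sim> y)" for x y t j k l
  proof -
    have K: "i \<in> K" "j \<in> K" "l \<in> K" using M_subset[of y] M_subset[of t] M by auto
    have a: "j \<sim> x" "x \<sim> j" "j \<sim> t" "j \<sim> l" "l \<sim> j" "x \<sim> l" "l \<sim> y" "y \<sim> l" "j \<sim> i" "i \<sim> j"
      "\<not> j \<sim> y" "\<not> y \<sim> j" "\<not> t \<sim> l" "\<not> i \<sim> x" "\<not> i \<sim> y" "\<not> i \<sim> t" 
      using K M ne notin_M[of j x] notin_M[of j t] notin_M[of l x] notin_M[of l y]
        in_M[of j y] in_M[of l t] in_M[of i x] in_M[of i y] in_M[of i t] K_adj by auto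
    show False
    proof (cases "t \<sim> x")
      case True
      then show False
        using kite_free[of j x t y i] a e adj_sym by blast
    next
      case False
      then show False
        using kite_free[of j x l y t] a e by blast
    qed
  qed
  have "y \<sim> x \<Longrightarrow> (y \<sim> t) \<noteq> (x \<sim> t)"
    using one[of x y t j k l] assms adj_commute by blast
  moreover have "x \<sim> t \<Longrightarrow> (y \<sim> t) \<noteq> (y \<sim> x)"
    using one[of x t y l k j] assms adj_commute by blast
  moreover have "y \<sim> t \<Longrightarrow> (y \<sim> x) \<noteq> (x \<sim> t)"
    using one[of y t x l j k] assms adj_commute by blast
  ultimately show ?thesis by blast
qed

lemma class_2_split:
  assumes "b \<sim> b'" "M b = {i, j}" "M b' = {i, j}" "M x = {i, k}" "i \<noteq> j" "i \<noteq> k" "j \<noteq> k"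
  shows "(x \<sim> b) \<noteq> (x \<sim> b')"
  using edge_split[of b b' i x j k] assms by auto

section \<open>The auxiliary graph \<open>N\<close>: degree bound and walks\<close>

definition N :: "'a \<Rightarrow> 'a set" where
  "N i = {j. j \<noteq> i \<and> (\<exists>x\<in>V. M x = {i, j})}"

lemma N_sym: "j \<in> N i \<longleftrightarrow> i \<in> N j"
  by (auto simp: N_def insert_commute)

lemma N_subset: "N i \<subseteq> K - {i}"
  using M_subset by (fastforce simp: N_def)

lemma M_cases:
  assumes "x \<in> V" "i \<in> M x"
  shows "M x = {i} \<or> (\<exists>j\<in>N i. M x = {i, j})"
proof (cases "M x = {i}")
  case False
  then obtain j where j: "j \<in> M x" "j \<noteq> i" using assms by blast
  then have "{i, j} = M x"
    using assms card_M_le_2[OF assms(1)] finite_M by (intro card_seteq) auto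
  then show ?thesis using j assms by (auto simp: N_def)
qed auto

text \<open>A vertex \<open>x\<close> with \<open>M x = {i, k}\<close> acts as a reference:
  adjacency to \<open>x\<close> separates the ends of every edge, by \<open>triangle_parity\<close>
  between the classes and by \<open>class_2_split\<close> inside the second.\<close>

lemma colourable_class_1_Un_class_2:
  assumes "k \<in> N i" "k \<noteq> j" "i \<noteq> j"
  shows "colourable 2 ({x \<in> V. M x = {i}} \<union> {x \<in> V. M x = {i, j}})"
proof -
  obtain x where x: "x \<in> V" "M x = {i, k}" "k \<noteq> i" using assms by (auto simp: N_def)
  show ?thesis
  proof (rule colourable_bipartite[where P = "\<lambda>w. w \<sim> x"])
    fix u v assume uv: "u \<in> {x \<in> V. M x = {i}} \<union> {x \<in> V. M x = {i, j}}"
      "v \<in> {x \<in> V. M x = {i}} \<union> {x \<in> V. M x = {i, j}}" "u \<sim> v"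
    have mixed: "(n \<sim> x) \<noteq> (b \<sim> x)"
      if "n \<in> V" "b \<in> V" "M n = {i}" "M b = {i, j}" "n \<sim> b" for n b
    proof (cases "n \<sim> x")
      case True
      then show ?thesis
        using triangle_parity[of x b n i j k] that x assms adj_commute by auto
    next
      case False
      then show ?thesis
        using triangle_parity[of b x n i k j] that x assms adj_commute by auto
    qed
    from uv(1,2) consider "M u = {i}" "M v = {i}" | "M u = {i}" "M v = {i, j}"
      | "M u = {i, j}" "M v = {i}" | "M u = {i, j}" "M v = {i, j}" by blast
    then show "(u \<sim> x) \<noteq> (v \<sim> x)"
    proof cases
      case 1
      then show ?thesis using singleton_class_independent uv by auto
    next
      case 2
      then show ?thesis using mixed uv by auto
    next
      case 3
      then show ?thesis using mixed[of v u] uv adj_sym by auto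
    next
      case 4
      then show ?thesis
        using class_2_split[of u v i j x k] uv x assms adj_commute by auto
    qed
  qed
qed

lemma not_colourable_star: "i \<in> K \<Longrightarrow> \<not> colourable 2 {x \<in> V. i \<in> M x}"
  using not_colourable_meeting[of "{i}"] by simp

text \<open>With three classes at \<open>i\<close>, \<open>triple_parity\<close> turns adjacency
  between different classes into a comparison of two sides. A third class is always at hand to place
  edges inside one class and the vertices with \<open>M n = {i}\<close>, so all vertices missing
  \<open>i\<close> are two-coloured, against \<open>not_colourable_star\<close>.\<close>

lemma card_N_le_2:
  assumes "i \<in> K"
  shows "card (N i) \<le> 2"
proof (rule ccontr)
  assume "\<not> card (N i) \<le> 2"
  then obtain S where "S \<subseteq> N i" "card S = 3"
    using obtain_subset_with_card_n[of 3 "N i"] by auto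
  then obtain j k l where jkl: "j \<in> N i" "k \<in> N i" "l \<in> N i" "j \<noteq> k" "k \<noteq> l" "j \<noteq> l"
    by (auto simp: card_3_iff)
  then obtain y x t where V: "y \<in> V" "x \<in> V" "t \<in> V"
    and M: "M y = {i, j}" "M x = {i, k}" "M t = {i, l}" and ni: "i \<noteq> j" "i \<noteq> k" "i \<noteq> l"
    by (auto simp: N_def)
  \<comment> \<open>\<open>s\<close> is a bipartition relative to \<open>x\<close>; a vertex with the same set as \<open>x\<close> has to be compared
    through \<open>y\<close> instead, as \<open>triple_parity\<close> only applies to three distinct sets.\<close>
  define s where "s w = (if M w = {i, k} then (w \<sim> y) \<noteq> (y \<sim> x) else w \<sim> x)" for w
  have parity: "(b \<sim> d) \<longleftrightarrow> (b \<sim> c) \<noteq> (c \<sim> d)"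
    if "b \<in> V" "c \<in> V" "d \<in> V" "M b = {i, p}" "M c = {i, q}" "M d = {i, r}"
      "i \<notin> {p, q, r}" "p \<noteq> q" "q \<noteq> r" "p \<noteq> r" for b c d p q r
    using triple_parity[of c b d i p q r] that by blast
  have ne: "{i, p} = {i, k} \<longleftrightarrow> p = k" if "p \<noteq> i" for p using that by (auto simp: doubleton_eq_iff)
  \<comment> \<open>When \<open>c\<close> lies in the class of \<open>y\<close>, the comparison
    cannot pass through \<open>y\<close> directly and is routed through \<open>t\<close>.\<close>
  have key1: "(b \<sim> c) \<longleftrightarrow> s b \<noteq> s c"
    if b: "b \<in> V" "M b = {i, k}" and c: "c \<in> V" "M c = {i, q}" "q \<noteq> k" "i \<noteq> q" for b c q
  proof (cases "q = j")
    case True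
    have "(b \<sim> c) \<longleftrightarrow> (b \<sim> t) \<noteq> (t \<sim> c)" "(b \<sim> t) \<longleftrightarrow> (b \<sim> y) \<noteq> (y \<sim> t)"
      "(y \<sim> t) \<longleftrightarrow> (y \<sim> x) \<noteq> (x \<sim> t)" "(t \<sim> c) \<longleftrightarrow> (t \<sim> x) \<noteq> (x \<sim> c)"
      using parity[of b t c k l q] parity[of b y t k j l] parity[of y x t j k l]
        parity[of t x c l k q] V M ni jkl b c True by auto
    then show ?thesis
      using b c ne[of q] adj_commute by (auto simp: s_def)
  next
    case False
    have "(b \<sim> c) \<longleftrightarrow> (b \<sim> y) \<noteq> (y \<sim> c)" "(y \<sim> c) \<longleftrightarrow> (y \<sim> x) \<noteq> (x \<sim> c)"
      using parity[of b y c k j q] parity[of y x c j k q] V M ni jkl b c False by auto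
    then show ?thesis
      using b c ne[of q] adj_commute by (auto simp: s_def)
  qed
  have key: "(b \<sim> c) \<longleftrightarrow> s b \<noteq> s c"
    if b: "b \<in> V" "M b = {i, p}" "i \<noteq> p" and c: "c \<in> V" "M c = {i, q}" "i \<noteq> q"
      and pq: "p \<noteq> q" for b c p q
  proof -
    consider "p = k" | "q = k" | "p \<noteq> k" "q \<noteq> k" by blast
    then show ?thesis
    proof cases
      case 1
      then show ?thesis using key1[of b c q] b c pq by auto
    next
      case 2
      then show ?thesis using key1[of c b p] b c pq adj_commute by auto
    next
      case 3
      then have "(b \<sim> c) \<longleftrightarrow> (b \<sim> x) \<noteq> (x \<sim> c)"
        using parity[of b x c p k q] V M ni b c pq by auto
      then show ?thesis using b c 3 ne[of p] ne[of q] adj_commute by (auto simp: s_def)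
    qed
  qed
  have other: "\<exists>d q. d \<in> V \<and> M d = {i, q} \<and> i \<noteq> q \<and> p \<noteq> q" for p
    using V M ni jkl by metis
  have same: "s b \<noteq> s c"
    if b: "b \<in> V" "c \<in> V" "M b = {i, p}" "M c = {i, p}" "i \<noteq> p" "b \<sim> c" for b c p
  proof -
    obtain d q where d: "d \<in> V" "M d = {i, q}" "i \<noteq> q" "p \<noteq> q" using other by blast
    have "(d \<sim> b) \<noteq> (d \<sim> c)" using class_2_split[of b c i p d q] b d by auto
    then show ?thesis using key[of d q b p] key[of d q c p] b d by auto
  qed
  \<comment> \<open>Neighbours of \<open>n\<close> in different classes are nonadjacent by
    \<open>triangle_parity\<close>; those in the same class agree on some \<open>d\<close> of
    another class.\<close>
  have one_side: "s b = s c"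
    if n: "n \<in> V" "M n = {i}" "n \<sim> b" "n \<sim> c" and b: "b \<in> V" "M b = {i, p}" "i \<noteq> p"
      and c: "c \<in> V" "M c = {i, q}" "i \<noteq> q" for n b c p q
  proof (cases "p = q")
    case False
    then have "\<not> c \<sim> b"
      using triangle_parity[of b c n i q p] n b c adj_commute by auto
    then show ?thesis using key[of c q b p] b c False by auto
  next
    case True
    obtain d r where d: "d \<in> V" "M d = {i, r}" "i \<noteq> r" "p \<noteq> r" using other by blast
    have "(d \<sim> n) \<noteq> (d \<sim> b)" "(d \<sim> n) \<noteq> (d \<sim> c)"
      using triangle_parity[of b d n i r p] triangle_parity[of c d n i r q] n b c d True by auto
    then show ?thesis using key[of d r b p] key[of d r c q] b c d True by auto
  qed
  \<comment> \<open>A vertex of the singleton class goes opposite to its neighbours in the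
    two-element classes, which share a side by \<open>one_side\<close>; without such neighbours it
    goes to the false side.\<close>
  define P where "P w = (if M w = {i} then \<exists>b\<in>V. (\<exists>p. M b = {i, p} \<and> i \<noteq> p) \<and> w \<sim> b \<and> \<not> s b else s w)" for w
  have P1: "P n \<noteq> s b"
    if n: "n \<in> V" "M n = {i}" "n \<sim> b" and b: "b \<in> V" "M b = {i, p}" "i \<noteq> p" for n b p
  proof (cases "s b")
    case True
    then have "s c" if "c \<in> V" "M c = {i, q}" "i \<noteq> q" "n \<sim> c" for c q
      using one_side[OF n(1,2,3) that(4) b that(1,2,3)] by simp
    then show ?thesis using True n by (auto simp: P_def)
  next
    case False
    then show ?thesis using n b by (auto simp: P_def)
  qed
  have "colourable 2 {x \<in> V. i \<in> M x}"
  proof (rule colourable_bipartite)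
    fix u v assume uv: "u \<in> {x \<in> V. i \<in> M x}" "v \<in> {x \<in> V. i \<in> M x}" "u \<sim> v"
    have cases: "M w = {i} \<or> (\<exists>p. M w = {i, p} \<and> i \<noteq> p) \<and> M w \<noteq> {i}" if "w \<in> {x \<in> V. i \<in> M x}" for w
      using M_cases[of w i] that by (auto simp: N_def)
    consider "M u = {i}" "M v = {i}" | p where "M u = {i}" "M v = {i, p}" "i \<noteq> p"
      | p where "M u = {i, p}" "i \<noteq> p" "M v = {i}"
      | p q where "M u = {i, p}" "i \<noteq> p" "M v = {i, q}" "i \<noteq> q"
      using cases[OF uv(1)] cases[OF uv(2)] by blast
    then show "P u \<noteq> P v"
    proof cases
      case 1
      then show ?thesis using singleton_class_independent uv by auto
    next
      case (2 p)
      then show ?thesis using P1[of u v p] uv by (auto simp: P_def)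
    next
      case (3 p)
      then show ?thesis using P1[of v u p] uv adj_sym by (auto simp: P_def)
    next
      case (4 p q)
      then have "s u \<noteq> s v"
        using key[of u p v q] same[of u v p] uv by (cases "p = q") auto
      then show ?thesis using 4 by (auto simp: P_def)
    qed
  qed
  then show False using not_colourable_star[OF assms] by blast
qed

text \<open>
  The edge \<open>{c, d}\<close> of the auxiliary graph leaves \<open>C\<close> and its vertices are not coloured yet. Adding
  \<open>d\<close> to \<open>C\<close> costs two colours, shared by \<open>{d}\<close> and \<open>{c, d}\<close>, unless \<open>d\<close> is a leaf, which costs three;
  the spare colour demanded by the last assumption pays for that.
\<close>
lemma no_partial_colouring:
  assumes "C \<subseteq> K" "c \<in> C" "d \<in> N c" "d \<notin> C"
    and "colourable r {x \<in> V. M x \<inter> C \<noteq> {} \<and> M x \<noteq> {c, d}}"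
    and "r \<le> 2 * card C" "r < 2 * card C \<or> (\<forall>i\<in>K. card (N i) \<noteq> 1)"
  shows False
  using assms
proof (induction "card (K - C)" arbitrary: C c d r rule: less_induct)
  case less
  let ?A = "{x \<in> V. M x \<inter> C \<noteq> {} \<and> M x \<noteq> {c, d}}"
  have d: "d \<in> K" "d \<noteq> c" "c \<in> N d" using less.prems(3) N_subset[of c] N_sym[of d c] by auto
  have finC: "finite C" using less.prems(1) finite_K by (rule finite_subset)
  have cardC: "card (insert d C) = Suc (card C)" using finC less.prems(4) by simp
  have C': "insert d C \<subseteq> K" "insert d C \<noteq> {}" using d less.prems(1) by auto
  have finN: "finite (N d)" using N_subset finite_K by (meson finite_Diff finite_subset)
  have class_d: "M x = {d} \<or> M x = {d, c} \<or> (\<exists>e\<in>N d. e \<noteq> c \<and> M x = {d, e})"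
    if "x \<in> V" "d \<in> M x" for x
    using M_cases[OF that] by auto
  show False
  proof (cases "\<exists>e\<in>N d. e \<noteq> c")
    case True
    then obtain e where e: "e \<in> N d" "e \<noteq> c" by blast
    \<comment> \<open>The degree bound makes the continuation of the walk from \<open>c\<close>
      through \<open>d\<close> unique.\<close>
    have eq: "e' = e" if "e' \<in> N d" "e' \<noteq> c" for e'
    proof (rule ccontr)
      assume "e' \<noteq> e"
      then have "card {c, e, e'} = 3" using e that by auto
      moreover have sub: "{c, e, e'} \<subseteq> N d" using e that d by simp
      ultimately show False
        using card_N_le_2[OF d(1)] card_mono[OF finN sub] by linarith
    qed
    have class_d': "M x = {d} \<or> M x = {d, c} \<or> M x = {d, e}" if x: "x \<in> V" "d \<in> M x" for x
    proof -
      consider "M x = {d}" | "M x = {d, c}" | e' where "e' \<in> N d" "e' \<noteq> c" "M x = {d, e'}"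
        using class_d[OF x] by auto
      then show ?thesis
      proof cases
        case (3 e')
        then show ?thesis using eq[of e'] by simp
      qed auto
    qed
    have "{d, e} \<noteq> {c, d}" using e by (simp add: doubleton_eq_iff)
    have "colourable 2 ({x \<in> V. M x = {d}} \<union> {x \<in> V. M x = {d, c}})"
      using colourable_class_1_Un_class_2[OF e d(2)] .
    then have col: "colourable (r + 2) (?A \<union> ({x \<in> V. M x = {d}} \<union> {x \<in> V. M x = {d, c}}))"
      by (rule colourable_Un[OF less.prems(5)])
    show False
    proof (cases "e \<in> C")
      case True
      \<comment> \<open>The walk has run back into \<open>C\<close>: vertices with
        \<open>M x = {d, e}\<close> meet \<open>C\<close> and are already coloured, so no class
        remains open.\<close>
      have "{x \<in> V. M x \<inter> insert d C \<noteq> {}} \<subseteq> ?A \<union> ({x \<in> V. M x = {d}} \<union> {x \<in> V. M x = {d, c}})"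
      proof
        fix x assume x: "x \<in> {x \<in> V. M x \<inter> insert d C \<noteq> {}}"
        show "x \<in> ?A \<union> ({x \<in> V. M x = {d}} \<union> {x \<in> V. M x = {d, c}})"
        proof (cases "d \<in> M x")
          case dM: True
          then show ?thesis
            using class_d'[of x] x True \<open>{d, e} \<noteq> {c, d}\<close> by auto
        next
          case False
          then show ?thesis using x by auto
        qed
      qed
      then have "colourable (2 * card (insert d C)) {x \<in> V. M x \<inter> insert d C \<noteq> {}}"
        using colourable_mono[OF col] less.prems(6) cardC by simp
      then show False using not_colourable_meeting[OF C'] by blast
    next
      case False
      \<comment> \<open>The walk goes on: \<open>{d, e}\<close> becomes the one uncoloured class,
        and \<open>r\<close> and \<open>2 * card C\<close> both grow by two.\<close>
      have "{x \<in> V. M x \<inter> insert d C \<noteq> {} \<and> M x \<noteq> {d, e}}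
          \<subseteq> ?A \<union> ({x \<in> V. M x = {d}} \<union> {x \<in> V. M x = {d, c}})"
      proof
        fix x assume x: "x \<in> {x \<in> V. M x \<inter> insert d C \<noteq> {} \<and> M x \<noteq> {d, e}}"
        show "x \<in> ?A \<union> ({x \<in> V. M x = {d}} \<union> {x \<in> V. M x = {d, c}})"
        proof (cases "d \<in> M x")
          case True
          then show ?thesis using class_d'[of x] x by auto
        next
          case False
          then show ?thesis using x by auto
        qed
      qed
      then have col': "colourable (r + 2) {x \<in> V. M x \<inter> insert d C \<noteq> {} \<and> M x \<noteq> {d, e}}"
        using colourable_mono[OF col] by blast
      have "K - insert d C \<subset> K - C" using d less.prems(4) by auto
      then have "card (K - insert d C) < card (K - C)"
        using finite_K by (simp add: psubset_card_mono)
      moreover have "e \<notin> insert d C" using False e N_subset[of d] by auto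
      ultimately show False
        using less.hyps[of "insert d C" d e "r + 2"] C'(1) e col' less.prems(6,7) cardC by simp
    qed
  next
    case False
    \<comment> \<open>At a leaf no reference vertex lets the two classes share colours; they cost
      \<open>1 + 2\<close>, covered by the two new colours and the spare one.\<close>
    then have "N d = {c}" using d by blast
    then have "card (N d) = 1" by simp
    then have r: "r < 2 * card C" using less.prems(7) d(1) by blast
    have "colourable (r + (1 + 2)) (?A \<union> ({x \<in> V. M x = {d}} \<union> {x \<in> V. M x = {d, c}}))"
      using d by (intro colourable_Un less.prems(5) colourable_class_1 colourable_class_2) auto
    moreover have "{x \<in> V. M x \<inter> insert d C \<noteq> {}} \<subseteq> ?A \<union> ({x \<in> V. M x = {d}} \<union> {x \<in> V. M x = {d, c}})"
    proof
      fix x assume x: "x \<in> {x \<in> V. M x \<inter> insert d C \<noteq> {}}"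
      show "x \<in> ?A \<union> ({x \<in> V. M x = {d}} \<union> {x \<in> V. M x = {d, c}})"
      proof (cases "d \<in> M x")
        case True
        then show ?thesis using class_d[of x] x False by auto
      next
        case False
        then show ?thesis using x by auto
      qed
    qed
    ultimately have "colourable (2 * card (insert d C)) {x \<in> V. M x \<inter> insert d C \<noteq> {}}"
      using r cardC by (elim colourable_mono) auto
    then show False using not_colourable_meeting[OF C'] by blast
  qed
qed

text \<open>Walks are started twice: first from a hypothetical leaf, and then, all leaves being
  excluded, from any vertex of \<open>K\<close>.\<close>

lemma contradiction: False
proof -
  have "K \<noteq> {}"
  proof
    assume "K = {}"
    then have "V = {}" using M_nonempty M_subset by fastforce
    then show False using not_colourable by (simp add: colourable_def)
  qed
  have no_leaf: "card (N i) \<noteq> 1" if i: "i \<in> K" for i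
  proof
    assume "card (N i) = 1"
    then obtain d where d: "N i = {d}" by (auto simp: card_1_singleton_iff)
    then have "d \<notin> {i}" using N_subset[of i] by auto
    \<comment> \<open>At a leaf only the singleton class precedes the walk; it takes one of the two
      colours and leaves the spare one.\<close>
    have "colourable 1 {x \<in> V. M x \<inter> {i} \<noteq> {} \<and> M x \<noteq> {i, d}}"
      using M_cases[of _ i] d by (intro colourable_mono[OF colourable_class_1[of i]]) auto
    then show False
      using no_partial_colouring[of "{i}" i d 1] i d \<open>d \<notin> {i}\<close> by auto
  qed
  obtain i where i: "i \<in> K" using \<open>K \<noteq> {}\<close> by blast
  have "N i \<noteq> {}"
  proof
    assume "N i = {}"
    then have "colourable 2 {x \<in> V. i \<in> M x}"
      using M_cases[of _ i] by (intro colourable_mono[OF colourable_class_1[of i]]) auto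
    then show False using not_colourable_star[OF i] by blast
  qed
  moreover have "finite (N i)" using N_subset finite_K by (meson finite_Diff finite_subset)
  ultimately have "card (N i) = 2"
    using no_leaf[OF i] card_N_le_2[OF i] by (metis One_nat_def Suc_1 card_gt_0_iff le_Suc_eq le_zero_eq not_less_zero)
  then obtain d e where de: "N i = {d, e}" "d \<noteq> e" by (auto simp: card_2_iff)
  then have ne: "d \<noteq> i" "e \<noteq> i" using N_subset[of i] by auto
  \<comment> \<open>The walk leaves \<open>i\<close> towards \<open>d\<close>, and a vertex with
    \<open>M x = {i, d}\<close> serves as the reference that two-colours the other classes at
    \<open>i\<close>.\<close>
  have "colourable 2 ({x \<in> V. M x = {i}} \<union> {x \<in> V. M x = {i, e}})"
    using colourable_class_1_Un_class_2[of d i e] de ne by auto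
  moreover have "M x = {i} \<or> M x = {i, e}" if "x \<in> V" "i \<in> M x" "M x \<noteq> {i, d}" for x
    using M_cases[OF that(1,2)] that(3) de(1) by auto
  ultimately have "colourable 2 {x \<in> V. M x \<inter> {i} \<noteq> {} \<and> M x \<noteq> {i, d}}"
    by (elim colourable_mono) auto
  then show False
    using no_partial_colouring[of "{i}" i d 2] i de ne no_leaf by auto
qed

end

section \<open>Induction over vertex sets and transfer to graphs\<close>

text \<open>The bound \<open>n\<close> varies in the induction, so the hypothesis for proper subsets
  is exactly the \<open>smaller_colourable\<close> required of a minimal counterexample.\<close>

theorem (in kite_P3P2_free) colourable_twice_clique_bound:
  assumes "finite V" "\<And>L. L \<subseteq> V \<Longrightarrow> complete L \<Longrightarrow> card L \<le> n"
  shows "colourable (2 * n) V"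
  using assms
proof (induction V arbitrary: n rule: finite_psubset_induct)
  case (psubset V)
  have "finite {L. L \<subseteq> V \<and> complete L}" using psubset.hyps by simp
  moreover have "{} \<in> {L. L \<subseteq> V \<and> complete L}" by (simp add: complete_def)
  ultimately obtain K where K: "K \<subseteq> V" "complete K"
    and max: "\<And>L. L \<subseteq> V \<Longrightarrow> complete L \<Longrightarrow> card L \<le> card K"
    using Max_in[of "card ` {L. L \<subseteq> V \<and> complete L}"] Max_ge[of "card ` {L. L \<subseteq> V \<and> complete L}"]
    by (smt (verit) empty_iff finite_imageI image_iff mem_Collect_eq)
  have "colourable (2 * card K) V"
  proof (rule ccontr)
    assume "\<not> colourable (2 * card K) V"
    then interpret minimal_counterexample adj V K
      using psubset.hyps K max psubset.IH by unfold_locales auto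
    show False by (rule contradiction)
  qed
  then show ?case
    using psubset.prems K by (elim colourable_mono) auto
qed

lemma kite_P3P2_free_adjacency:
  assumes "graph G" "free_of (with_proj P3_union_P2) G" "free_of (with_proj kite) G"
  shows "kite_P3P2_free (\<lambda>u v. u \<rightarrow>\<^bsub>G\<^esub> v)"
proof -
  interpret graph G by fact
  have sym: "v \<rightarrow>\<^bsub>G\<^esub> u" if "u \<rightarrow>\<^bsub>G\<^esub> v" for u v
    using that by (rule graph_symmetric)
  show ?thesis
  proof
    show "v \<rightarrow>\<^bsub>G\<^esub> u" if "u \<rightarrow>\<^bsub>G\<^esub> v" for u v
      using that by (rule sym)
    show irrefl: "\<not> u \<rightarrow>\<^bsub>G\<^esub> u" for u
      using adj_not_same by blast
    show False
      if e: "a \<rightarrow>\<^bsub>G\<^esub> b" "a \<rightarrow>\<^bsub>G\<^esub> c" "b \<rightarrow>\<^bsub>G\<^esub> c" "b \<rightarrow>\<^bsub>G\<^esub> d" "c \<rightarrow>\<^bsub>G\<^esub> d" "a \<rightarrow>\<^bsub>G\<^esub> e"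
        "\<not> a \<rightarrow>\<^bsub>G\<^esub> d" "\<not> e \<rightarrow>\<^bsub>G\<^esub> b" "\<not> e \<rightarrow>\<^bsub>G\<^esub> c" "\<not> e \<rightarrow>\<^bsub>G\<^esub> d" for a b c d e
    proof -
      have e': "b \<rightarrow>\<^bsub>G\<^esub> a" "c \<rightarrow>\<^bsub>G\<^esub> a" "c \<rightarrow>\<^bsub>G\<^esub> b" "d \<rightarrow>\<^bsub>G\<^esub> b" "d \<rightarrow>\<^bsub>G\<^esub> c" "e \<rightarrow>\<^bsub>G\<^esub> a"
        "\<not> d \<rightarrow>\<^bsub>G\<^esub> a" "\<not> b \<rightarrow>\<^bsub>G\<^esub> e" "\<not> c \<rightarrow>\<^bsub>G\<^esub> e" "\<not> d \<rightarrow>\<^bsub>G\<^esub> e"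
        using e sym by blast+
      \<comment> \<open>The list follows the numbering of \<open>kite\<close>: \<open>0\<close> and
        \<open>3\<close> are the nonadjacent diamond vertices, and \<open>4\<close> is the pendant
        one.\<close>
      define f where "f = (!) [a, b, c, d, e]"
      have f: "f 0 = a" "f 1 = b" "f (Suc 0) = b" "f 2 = c" "f 3 = d" "f 4 = e"
        by (simp_all add: f_def)
      have dist: "a \<noteq> b" "a \<noteq> c" "a \<noteq> d" "a \<noteq> e" "b \<noteq> c" "b \<noteq> d" "b \<noteq> e" "c \<noteq> d" "c \<noteq> e" "d \<noteq> e"
        using e e' irrefl by blast+
      have verts: "a \<in> verts G" "b \<in> verts G" "c \<in> verts G" "d \<in> verts G" "e \<in> verts G"
        using e e' adj_in_verts by blast+
      have pv: "pverts kite = {0, 1, 2, 3, 4}"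
        by (auto simp: kite_def Let_def)
      have "inj_on f (pverts kite)" "f ` pverts kite \<subseteq> verts G"
        using dist verts by (simp_all add: pv f inj_on_def)
      moreover have "\<forall>u\<in>pverts kite. \<forall>v\<in>pverts kite. (u, v) \<in> parcs kite \<longleftrightarrow> f u \<rightarrow>\<^bsub>G\<^esub> f v"
        unfolding pv using e e' irrefl by (simp add: kite_def Let_def f)
      ultimately show False
        using assms(3) free_of_iff[OF pair_graph_kite \<open>graph G\<close>] by blast
    qed
    show False
      if e: "a \<rightarrow>\<^bsub>G\<^esub> b" "b \<rightarrow>\<^bsub>G\<^esub> c" "a \<noteq> c" "\<not> a \<rightarrow>\<^bsub>G\<^esub> c" "d \<rightarrow>\<^bsub>G\<^esub> e"
        "\<not> a \<rightarrow>\<^bsub>G\<^esub> d" "\<not> a \<rightarrow>\<^bsub>G\<^esub> e" "\<not> b \<rightarrow>\<^bsub>G\<^esub> d" "\<not> b \<rightarrow>\<^bsub>G\<^esub> e" "\<not> c \<rightarrow>\<^bsub>G\<^esub> d" "\<not> c \<rightarrow>\<^bsub>G\<^esub> e" for a b c d e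
    proof -
      have e': "b \<rightarrow>\<^bsub>G\<^esub> a" "c \<rightarrow>\<^bsub>G\<^esub> b" "\<not> c \<rightarrow>\<^bsub>G\<^esub> a" "e \<rightarrow>\<^bsub>G\<^esub> d" "\<not> d \<rightarrow>\<^bsub>G\<^esub> a" "\<not> e \<rightarrow>\<^bsub>G\<^esub> a"
        "\<not> d \<rightarrow>\<^bsub>G\<^esub> b" "\<not> e \<rightarrow>\<^bsub>G\<^esub> b" "\<not> d \<rightarrow>\<^bsub>G\<^esub> c" "\<not> e \<rightarrow>\<^bsub>G\<^esub> c"
        using e sym by blast+
      define f :: "nat + nat \<Rightarrow> 'a" where "f = case_sum ((!) [a, b, c]) ((!) [d, e])"
      have f: "f (Inl 0) = a" "f (Inl 1) = b" "f (Inl (Suc 0)) = b" "f (Inl 2) = c"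
        "f (Inr 0) = d" "f (Inr 1) = e" "f (Inr (Suc 0)) = e"
        by (simp_all add: f_def)
      have dist: "a \<noteq> b" "a \<noteq> d" "a \<noteq> e" "b \<noteq> c" "b \<noteq> d" "b \<noteq> e" "c \<noteq> d" "c \<noteq> e" "d \<noteq> e"
        using e e' irrefl by blast+
      have verts: "a \<in> verts G" "b \<in> verts G" "c \<in> verts G" "d \<in> verts G" "e \<in> verts G"
        using e e' adj_in_verts by blast+
      have pv: "pverts P3_union_P2 = {Inl 0, Inl 1, Inl 2, Inr 0, Inr 1}"
        by (auto simp: disjoint_union_def path_graph_def)
      have "inj_on f (pverts P3_union_P2)" "f ` pverts P3_union_P2 \<subseteq> verts G"
        using dist \<open>a \<noteq> c\<close> verts by (simp_all add: pv f inj_on_def)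
      moreover have "\<forall>u\<in>pverts P3_union_P2. \<forall>v\<in>pverts P3_union_P2.
          (u, v) \<in> parcs P3_union_P2 \<longleftrightarrow> f u \<rightarrow>\<^bsub>G\<^esub> f v"
        unfolding pv parcs_P3_union_P2 using e e' irrefl by (simp add: Let_def f)
      ultimately show False
        using assms(2) free_of_iff[OF pair_graph_disjoint_union \<open>graph G\<close>] pair_graph_path_graph
        by blast
    qed
  qed
qed

theorem theorem1p3:
  fixes G :: "('a, 'b) pre_digraph"
  assumes "graph G"
    and "free_of (with_proj P3_union_P2) G"
    and "free_of (with_proj kite) G"
  shows "chromatic_number G \<le> 2 * clique_number G"
proof -
  interpret graph G by fact
  interpret kite_P3P2_free "\<lambda>u v. u \<rightarrow>\<^bsub>G\<^esub> v"
    using assms by (rule kite_P3P2_free_adjacency)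
  have "card L \<le> clique_number G" if "L \<subseteq> verts G" "complete L" for L
  proof -
    have "clique G L" using that by (simp add: clique_def complete_def)
    then show ?thesis
      unfolding clique_number_def using finite_clique_sizes by (intro Max_ge) auto
  qed
  then have "colourable (2 * clique_number G) (verts G)"
    by (intro colourable_twice_clique_bound) auto
  then obtain c where "c ` verts G \<subseteq> {..<2 * clique_number G}"
    "\<forall>u\<in>verts G. \<forall>v\<in>verts G. u \<rightarrow>\<^bsub>G\<^esub> v \<longrightarrow> c u \<noteq> c v"
    unfolding colourable_def by blast
  then have "proper_colouring G (2 * clique_number G) c"
    unfolding proper_colouring_def using adj_in_verts by blast
  then show ?thesis
    unfolding chromatic_number_def by (intro Least_le) blast
qed

end
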